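(* Consider an imprecise Markov chain with state space $\mathcal{X}$, lower transition operator $\underline{\mathrm{T}}$ and upper transition operator $\overline{\mathrm{T}}$ (both extended to extended real maps on $\mathcal{X}$). The lower and upper expected transition (and, for $x=y$, return) times $\underline{\tau}_{x\to y}$ and $\overline{\tau}_{x\to y}$ satisfy the systems of non-linear equations $$\underline{\tau}_{x\to y}=1+\underline{\mathrm{T}}\Big(\sum_{z\in\mathcal{X}\setminus\{y\}}\mathbb{I}_{\{z\}}\,\underline{\tau}_{z\to y}\Big)(x)\quad\text{for all }x,y\in\mathcal{X},$$ $$\overline{\tau}_{x\to y}=1+\overline{\mathrm{T}}\Big(\sum_{z\in\mathcal{X}\setminus\{y\}}\mathbb{I}_{\{z\}}\,\overline{\tau}_{z\to y}\Big)(x)\quad\text{for all }x,y\in\mathcal{X}.$$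
   Context: Write $\mathbb{N}=\{1,2,\dots\}$, $\mathbb{N}_0=\mathbb{N}\cup\{0\}$. Let $\mathcal{X}$ be a non-empty finite set (state space). A situation is a finite string $x_{1:n}=(x_1,\dots,x_n)\in\mathcal{X}^n$, $n\in\mathbb{N}_0$; the empty string is $\square$. A path is an element $\omega=(\omega_1,\omega_2,\dots)$ of $\Omega:=\mathcal{X}^{\mathbb{N}}$; $\omega^n:=(\omega_1,\dots,\omega_n)$. For a situation $s=x_{1:n}$, $\Gamma(s):=\{\omega\in\Omega:\omega^n=x_{1:n}\}$. A gamble on a set $Y$ is a bounded function $Y\to\mathbb{R}$; $\mathcal{G}(Y)$ is the set of these. A lower expectation on $\mathcal{G}(Y)$ is a functional $\underline{E}\colon\mathcal{G}(Y)\to\mathbb{R}$ with $\underline{E}(f)\geq\inf f$, $\underline{E}(f+g)\geq\underline{E}(f)+\underline{E}(g)$ and $\underline{E}(\lambda f)=\lambda\underline{E}(f)$ for all gambles $f,g$ and real $\lambda\geq0$. An imprecise Markov chain attaches to each situation $x_{1:n}$ a lower expectation $\underline{Q}(\cdot|x_{1:n})$ on $\mathcal{G}(\mathcal{X})$ such that $\underline{Q}(\cdot|x_{1:n})=\underline{Q}(\cdot|x_n)$ for all $n\in\mathbb{N}$ and $x_{1:n}\in\mathcal{X}^n$. For extended real maps $g\colon\mathcal{X}\to\mathbb{R}\cup\{-\infty,+\infty\}$ let $\underline{\mathrm{T}}g(x):=\sup\{\underline{Q}(h|x):h\in\mathcal{G}(\mathcal{X}),\ h\leq g\}$ (which equals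 $\underline{Q}(g|x)$ when $g$ is a gamble) and $\overline{\mathrm{T}}g:=-\underline{\mathrm{T}}(-g)$; $\sup\emptyset=-\infty$. A real process is a real-valued map $\mathcal{F}$ on situations; $\Delta\mathcal{F}(x_{1:n})(x_{n+1}):=\mathcal{F}(x_{1:n+1})-\mathcal{F}(x_{1:n})$. A submartingale is a real process $\mathcal{M}$ with $\underline{Q}(\Delta\mathcal{M}(t)|t)\geq0$ for all situations $t$. For an extended real variable $f\colon\Omega\to\mathbb{R}\cup\{-\infty,+\infty\}$ and a situation $t$, $$\underline{E}(f|t):=\sup\{\mathcal{M}(t):\mathcal{M}\text{ a bounded above submartingale with }\limsup_{n\to\infty}\mathcal{M}(\omega^n)\leq f(\omega)\text{ for all }\omega\in\Gamma(t)\},$$ and $\overline{E}(f|t):=-\underline{E}(-f|t)$. For $x,y\in\mathcal{X}$ let $\tau^1_{x\to y}(\omega):=0$ if $\omega_1\neq x$ and $\tau^1_{x\to y}(\omega):=\inf\{m\in\mathbb{N}:\omega_{1+m}=y\}$ if $\omega_1=x$ (with $\inf\emptyset=+\infty$), and define $\underline{\tau}_{x\to y}:=\underline{E}(\tau^1_{x\to y}|x)$ and $\overline{\tau}_{x\to y}:=\overline{E}(\tau^1_{x\to y}|x)$ (conditioning on the situation of length one consisting of $x$). $\mathbb{I}_{\{z\}}$ is the indicator of $\{z\}$ on $\mathcal{X}$, and $0\cdot(+\infty)=0$. *)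

theory Defs
  imports "HOL-Analysis.Analysis"
begin

definition gambles :: "('b \<Rightarrow> real) set" where
  "gambles = {f. bounded (range f)}"

definition lower_expectation :: "(('b \<Rightarrow> real) \<Rightarrow> real) \<Rightarrow> bool" where
  "lower_expectation E \<longleftrightarrow>
     (\<forall>f \<in> gambles. E f \<ge> (INF y. f y)) \<and>
     (\<forall>f \<in> gambles. \<forall>g \<in> gambles. E (\<lambda>y. f y + g y) \<ge> E f + E g) \<and>
     (\<forall>f \<in> gambles. \<forall>c \<ge> 0. E (\<lambda>y. c * f y) = c * E f)"

(* The state space is a finite type 'a. Situations are lists, and Q s is the local model
   attached to the situation s. *)

definition imprecise_markov_chain :: "('a::finite list \<Rightarrow> ('a \<Rightarrow> real) \<Rightarrow> real) \<Rightarrow> bool" where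
  "imprecise_markov_chain Q \<longleftrightarrow>
     (\<forall>s. lower_expectation (Q s)) \<and> (\<forall>s. s \<noteq> [] \<longrightarrow> Q s = Q [last s])"

definition lower_transition ::
    "('a::finite list \<Rightarrow> ('a \<Rightarrow> real) \<Rightarrow> real) \<Rightarrow> ('a \<Rightarrow> ereal) \<Rightarrow> 'a \<Rightarrow> ereal" where
  "lower_transition Q g x = Sup {ereal (Q [x] h) | h. h \<in> gambles \<and> (\<forall>z. ereal (h z) \<le> g z)}"

definition upper_transition ::
    "('a::finite list \<Rightarrow> ('a \<Rightarrow> real) \<Rightarrow> real) \<Rightarrow> ('a \<Rightarrow> ereal) \<Rightarrow> 'a \<Rightarrow> ereal" where
  "upper_transition Q g x = - lower_transition Q (\<lambda>z. - g z) x"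

(* Paths are indexed from 0: the first state of the path \<omega> is \<omega> 0. *)

definition path_prefix :: "(nat \<Rightarrow> 'a) \<Rightarrow> nat \<Rightarrow> 'a list" where
  "path_prefix \<omega> n = map \<omega> [0..<n]"

definition cylinder :: "'a list \<Rightarrow> (nat \<Rightarrow> 'a) set" where
  "cylinder s = {\<omega>. path_prefix \<omega> (length s) = s}"

definition process_difference :: "('a list \<Rightarrow> real) \<Rightarrow> 'a list \<Rightarrow> 'a \<Rightarrow> real" where
  "process_difference F s x = F (s @ [x]) - F s"

definition submartingale ::
    "('a::finite list \<Rightarrow> ('a \<Rightarrow> real) \<Rightarrow> real) \<Rightarrow> ('a list \<Rightarrow> real) \<Rightarrow> bool" where
  "submartingale Q M \<longleftrightarrow> (\<forall>t. Q t (process_difference M t) \<ge> 0)"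

definition global_lower_expectation ::
    "('a::finite list \<Rightarrow> ('a \<Rightarrow> real) \<Rightarrow> real) \<Rightarrow> ((nat \<Rightarrow> 'a) \<Rightarrow> ereal) \<Rightarrow> 'a list \<Rightarrow> ereal" where
  "global_lower_expectation Q f t =
     Sup {ereal (M t) | M. submartingale Q M \<and> bdd_above (range M) \<and>
            (\<forall>\<omega> \<in> cylinder t. limsup (\<lambda>n. ereal (M (path_prefix \<omega> n))) \<le> f \<omega>)}"

definition global_upper_expectation ::
    "('a::finite list \<Rightarrow> ('a \<Rightarrow> real) \<Rightarrow> real) \<Rightarrow> ((nat \<Rightarrow> 'a) \<Rightarrow> ereal) \<Rightarrow> 'a list \<Rightarrow> ereal" where
  "global_upper_expectation Q f t = - global_lower_expectation Q (\<lambda>\<omega>. - f \<omega>) t"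

(* With indexing from 0, the state reached m steps after the first one is \<omega> m. *)

definition transition_time :: "'a \<Rightarrow> 'a \<Rightarrow> (nat \<Rightarrow> 'a) \<Rightarrow> ereal" where
  "transition_time x y \<omega> =
     (if \<omega> 0 \<noteq> x then 0 else Inf {ereal (real m) | m. m \<ge> 1 \<and> \<omega> m = y})"

definition lower_transition_time ::
    "('a::finite list \<Rightarrow> ('a \<Rightarrow> real) \<Rightarrow> real) \<Rightarrow> 'a \<Rightarrow> 'a \<Rightarrow> ereal" where
  "lower_transition_time Q x y = global_lower_expectation Q (transition_time x y) [x]"

definition upper_transition_time ::
    "('a::finite list \<Rightarrow> ('a \<Rightarrow> real) \<Rightarrow> real) \<Rightarrow> 'a \<Rightarrow> 'a \<Rightarrow> ereal" where
  "upper_transition_time Q x y = global_upper_expectation Q (transition_time x y) [x]"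

end

theory Submission
  imports Defs
begin

text \<open>The equations come from first-step analysis. Two facts about the global lower expectation
  carry it.

  The first is a one-step law of iterated expectations (\<open>global_lower_expectation_step\<close>): its value
  in the situation \<open>[x]\<close> is the lower transition operator applied to its values in the children
  \<open>[x, z]\<close>.

  The second is that its value in a situation \<open>s\<close> only depends on how the local models and the
  variable behave on the continuations of \<open>s\<close> (\<open>global_lower_expectation_eq_Sup_tail\<close>). A process that
  is a submartingale from \<open>s\<close> onwards extends to a submartingale everywhere, by giving it its value
  in \<open>s\<close> off the continuations of \<open>s\<close>. Since the local model only depends on the last state, the past
  can be forgotten (\<open>global_lower_expectation_Markov\<close>).

  The transition time from \<open>x\<close> to \<open>y\<close> is \<open>1\<close> on paths through \<open>[x, y]\<close>, and it is one more than the
  transition time from \<open>z\<close> to \<open>y\<close> of the path without its first state on paths through \<open>[x, z]\<close> with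
  \<open>z \<noteq> y\<close>. So its global lower expectation in \<open>[x, z]\<close> is \<open>1\<close>, respectively \<open>1\<close> plus the expected
  transition time from \<open>z\<close>, and the constant \<open>1\<close> can be pulled out of the lower transition operator.
  The upper equation is the same argument for the negated transition times, with the constant \<open>-1\<close>;
  \<open>global_lower_expectation_first_step\<close> covers both. No integrability enters: all these facts hold
  for extended real variables, including the values \<open>\<plusminus>\<infinity>\<close>.\<close>

section \<open>Lower expectations on a finite space\<close>

lemma gambles_finite [simp]: "(h :: 'a::finite \<Rightarrow> real) \<in> gambles"
  by (simp add: gambles_def finite_imp_bounded)

lemma lower_expectation_const_le:
  fixes h :: "'a::finite \<Rightarrow> real"
  assumes "lower_expectation E" "\<And>z. c \<le> h z"
  shows "c \<le> E h"
proof -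
  have "c \<le> (INF z. h z)"
    using assms(2) by (intro cINF_greatest) auto
  also have "\<dots> \<le> E h"
    by (rule assms(1)[unfolded lower_expectation_def, THEN conjunct1, THEN bspec, OF gambles_finite])
  finally show ?thesis .
qed

lemma lower_expectation_superadd:
  fixes g h :: "'a::finite \<Rightarrow> real"
  assumes "lower_expectation E"
  shows "E g + E h \<le> E (\<lambda>z. g z + h z)"
  by (rule assms[unfolded lower_expectation_def, THEN conjunct2, THEN conjunct1,
        THEN bspec, OF gambles_finite, THEN bspec, OF gambles_finite])

lemma lower_expectation_mono:
  fixes g h :: "'a::finite \<Rightarrow> real"
  assumes "lower_expectation E" "\<And>z. g z \<le> h z"
  shows "E g \<le> E h"
proof -
  have "0 \<le> E (\<lambda>z. h z - g z)"
    by (rule lower_expectation_const_le[OF assms(1)]) (simp add: assms(2))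
  moreover have "E g + E (\<lambda>z. h z - g z) \<le> E h"
    using lower_expectation_superadd[OF assms(1), of g "\<lambda>z. h z - g z"] by simp
  ultimately show ?thesis by simp
qed

lemma lower_expectation_add_const:
  fixes h :: "'a::finite \<Rightarrow> real"
  assumes E: "lower_expectation E"
  shows "E (\<lambda>z. h z + c) = E h + c"
proof (rule antisym)
  have *: "E g + b \<le> E (\<lambda>z. g z + b)" for g :: "'a \<Rightarrow> real" and b
    using lower_expectation_superadd[OF E, of g "\<lambda>_. b"]
      lower_expectation_const_le[OF E, of b "\<lambda>_. b"] by simp
  show "E h + c \<le> E (\<lambda>z. h z + c)" by (rule *)
  show "E (\<lambda>z. h z + c) \<le> E h + c"
    using *[of "\<lambda>z. h z + c" "-c"] by simp
qed

lemma lower_expectation_zero: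
  assumes "lower_expectation (E :: ('a::finite \<Rightarrow> real) \<Rightarrow> real)"
  shows "E (\<lambda>_. 0) = 0"
proof -
  have "E (\<lambda>_. 0 * 0) = 0 * E (\<lambda>_. 0)"
    by (rule assms[unfolded lower_expectation_def, THEN conjunct2, THEN conjunct2, THEN bspec,
          OF gambles_finite, THEN spec, THEN mp, OF order_refl])
  then show ?thesis by simp
qed

lemma lower_expectation_nonneg_witness:
  fixes h :: "'a::finite \<Rightarrow> real"
  assumes E: "lower_expectation E" and "0 \<le> E h"
  shows "\<exists>z. 0 \<le> h z"
proof (rule ccontr)
  assume "\<not> ?thesis"
  then have neg: "h z < 0" for z by (simp add: not_le)
  have "finite (range h)" "range h \<noteq> {}" by auto
  then have le: "h z \<le> Max (range h)" for z by simp
  have "Max (range h) \<in> range h" by (intro Max_in) auto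
  with neg have "Max (range h) < 0" by auto
  have "E h \<le> E (\<lambda>_. 0 + Max (range h))"
    using le by (intro lower_expectation_mono[OF E]) simp
  also have "\<dots> = Max (range h)"
    by (subst lower_expectation_add_const[OF E]) (simp add: lower_expectation_zero[OF E])
  finally show False
    using \<open>0 \<le> E h\<close> \<open>Max (range h) < 0\<close> by simp
qed

lemma imprecise_markov_chain_lower_expectation:
  "imprecise_markov_chain Q \<Longrightarrow> lower_expectation (Q s)"
  unfolding imprecise_markov_chain_def by blast

lemma imprecise_markov_chain_append:
  assumes "imprecise_markov_chain Q" "t \<noteq> []"
  shows "Q (s @ t) = Q t"
proof -
  have *: "Q u = Q [last u]" if "u \<noteq> []" for u
    using assms(1) that unfolding imprecise_markov_chain_def by blast
  have "Q (s @ t) = Q [last (s @ t)]"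
    using \<open>t \<noteq> []\<close> by (intro *) simp
  also have "\<dots> = Q t"
    using \<open>t \<noteq> []\<close> *[of t] by simp
  finally show ?thesis .
qed

lemma ereal_add_le_iff: "ereal c + a \<le> b \<longleftrightarrow> a \<le> ereal (- c) + b"
  by (cases a; cases b) auto

lemma lower_transition_add_const:
  assumes Q: "imprecise_markov_chain Q"
  shows "lower_transition Q (\<lambda>z. ereal c + g z) x = ereal c + lower_transition Q g x"
proof (rule antisym)
  have *: "lower_transition Q g' x \<le> ereal (- b) + lower_transition Q (\<lambda>z. ereal b + g' z) x"
    for g' b
    unfolding lower_transition_def[of Q g']
  proof (rule Sup_least, clarify)
    fix h assume h: "\<forall>z. ereal (h z) \<le> g' z"
    have "ereal b + ereal (Q [x] h) = ereal (Q [x] (\<lambda>z. h z + b))"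
      by (simp add: lower_expectation_add_const[OF imprecise_markov_chain_lower_expectation[OF Q]])
    also have "\<dots> \<le> lower_transition Q (\<lambda>z. ereal b + g' z) x"
      unfolding lower_transition_def
    proof (rule Sup_upper, clarsimp)
      show "\<exists>h'. Q [x] (\<lambda>z. h z + b) = Q [x] h' \<and> (\<forall>z. ereal (h' z) \<le> ereal b + g' z)"
        using h by (intro exI[of _ "\<lambda>z. h z + b"])
          (auto simp: add.commute[of _ b] simp flip: plus_ereal.simps intro: add_left_mono)
    qed
    finally show "ereal (Q [x] h) \<le> ereal (- b) + lower_transition Q (\<lambda>z. ereal b + g' z) x"
      by (simp only: ereal_add_le_iff)
  qed
  show "lower_transition Q (\<lambda>z. ereal c + g z) x \<le> ereal c + lower_transition Q g x"
    using *[of "\<lambda>z. ereal c + g z" "-c"] by (simp add: add.assoc[symmetric] zero_ereal_def[symmetric])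
  show "ereal c + lower_transition Q g x \<le> lower_transition Q (\<lambda>z. ereal c + g z) x"
    using *[of g c] by (simp only: ereal_add_le_iff)
qed

section \<open>The global lower expectation seen from a situation\<close>

text \<open>The path that runs through the situation \<open>s\<close> and then follows \<open>\<omega>\<close>.\<close>

definition prepend :: "'a list \<Rightarrow> (nat \<Rightarrow> 'a) \<Rightarrow> nat \<Rightarrow> 'a" where
  "prepend s \<omega> i = (if i < length s then s ! i else \<omega> (i - length s))"

lemma prepend_Nil [simp]: "prepend [] \<omega> = \<omega>"
  by (simp add: prepend_def fun_eq_iff)

lemma prepend_append: "prepend (s @ t) \<omega> = prepend s (prepend t \<omega>)"
  by (auto simp: prepend_def fun_eq_iff nth_append)

lemma prepend_Cons_0 [simp]: "prepend (x # s) \<omega> 0 = x"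
  and prepend_Cons_Suc [simp]: "prepend (x # s) \<omega> (Suc i) = prepend s \<omega> i"
  by (simp_all add: prepend_def)

lemma prepend_singleton_tail: "prepend [\<omega> 0] (\<lambda>i. \<omega> (Suc i)) = \<omega>"
  by (auto simp: prepend_def fun_eq_iff)

lemma path_prefix_prepend: "path_prefix (prepend s \<omega>) (length s + n) = s @ path_prefix \<omega> n"
  by (auto simp: path_prefix_def prepend_def intro!: nth_equalityI simp: nth_append)

lemma cylinder_eq_range_prepend: "cylinder s = range (prepend s)"
proof
  show "range (prepend s) \<subseteq> cylinder s"
  proof clarify
    fix \<omega>
    show "prepend s \<omega> \<in> cylinder s"
      using path_prefix_prepend[of s \<omega> 0] by (simp add: cylinder_def path_prefix_def)
  qed
  show "cylinder s \<subseteq> range (prepend s)"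
  proof
    fix \<omega> assume "\<omega> \<in> cylinder s"
    then have eq: "path_prefix \<omega> (length s) = s" by (simp add: cylinder_def)
    have nth: "s ! i = \<omega> i" if "i < length s" for i
      using that arg_cong[OF eq, of "\<lambda>l. l ! i"] by (simp add: path_prefix_def)
    have "\<omega> = prepend s (\<lambda>i. \<omega> (i + length s))"
      by (auto simp: fun_eq_iff prepend_def nth)
    then show "\<omega> \<in> range (prepend s)" by blast
  qed
qed

lemma limsup_path_prefix_prepend:
  "limsup (\<lambda>n. F (path_prefix (prepend s \<omega>) n)) = limsup (\<lambda>n. F (s @ path_prefix \<omega> n))"
  for F :: "'a list \<Rightarrow> ereal"
  using limsup_shift_k[of "\<lambda>n. F (path_prefix (prepend s \<omega>) n)" "length s"]
  by (simp add: path_prefix_prepend add.commute[of _ "length s"])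

text \<open>\<open>tail_submartingale Q s f N\<close> says that \<open>u \<mapsto> N u\<close> behaves on the continuations \<open>s @ u\<close> of the
  situation \<open>s\<close> as the submartingales in the definition of the global lower expectation of \<open>f\<close>
  in \<open>s\<close> do. Nothing is asked in the situations that do not continue \<open>s\<close>.\<close>

definition tail_submartingale ::
    "('a::finite list \<Rightarrow> ('a \<Rightarrow> real) \<Rightarrow> real) \<Rightarrow> 'a list \<Rightarrow> ((nat \<Rightarrow> 'a) \<Rightarrow> ereal) \<Rightarrow>
      ('a list \<Rightarrow> real) \<Rightarrow> bool" where
  "tail_submartingale Q s f N \<longleftrightarrow>
     (\<forall>u. 0 \<le> Q (s @ u) (process_difference N u)) \<and> bdd_above (range N) \<and>
     (\<forall>\<omega>. limsup (\<lambda>n. ereal (N (path_prefix \<omega> n))) \<le> f (prepend s \<omega>))"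

text \<open>The global lower expectation in \<open>s\<close> is determined by the continuations of \<open>s\<close>, which is what
  makes it possible to compare different situations and to glue submartingales.\<close>

lemma global_lower_expectation_eq_Sup_tail:
  assumes Q: "imprecise_markov_chain Q"
  shows "global_lower_expectation Q f s = Sup {ereal (N []) | N. tail_submartingale Q s f N}"
proof -
  have "(\<exists>M. a = ereal (M s) \<and> submartingale Q M \<and> bdd_above (range M) \<and>
            (\<forall>\<omega>\<in>cylinder s. limsup (\<lambda>n. ereal (M (path_prefix \<omega> n))) \<le> f \<omega>))
        \<longleftrightarrow> (\<exists>N. a = ereal (N []) \<and> tail_submartingale Q s f N)" (is "?L \<longleftrightarrow> ?R") for a
  proof
    assume ?L
    then obtain M where M: "a = ereal (M s)" "submartingale Q M" "bdd_above (range M)"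
      "\<And>\<omega>. \<omega> \<in> cylinder s \<Longrightarrow> limsup (\<lambda>n. ereal (M (path_prefix \<omega> n))) \<le> f \<omega>" by auto
    have "tail_submartingale Q s f (\<lambda>u. M (s @ u))"
      unfolding tail_submartingale_def
    proof (intro conjI allI)
      show "0 \<le> Q (s @ u) (process_difference (\<lambda>u. M (s @ u)) u)" for u
        using M(2)[unfolded submartingale_def, THEN spec, of "s @ u"]
        by (simp add: process_difference_def[abs_def])
      show "bdd_above (range (\<lambda>u. M (s @ u)))"
        by (rule bdd_above_mono[OF M(3)]) auto
      show "limsup (\<lambda>n. ereal (M (s @ path_prefix \<omega> n))) \<le> f (prepend s \<omega>)" for \<omega>
        using M(4)[of "prepend s \<omega>"] limsup_path_prefix_prepend[of "\<lambda>t. ereal (M t)" s \<omega>]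
        by (simp add: cylinder_eq_range_prepend)
    qed
    then show ?R using M(1) by (intro exI[of _ "\<lambda>u. M (s @ u)"]) simp
  next
    assume ?R
    then obtain N where a: "a = ereal (N [])" and N: "\<And>u. 0 \<le> Q (s @ u) (process_difference N u)"
      "bdd_above (range N)"
      "\<And>\<omega>. limsup (\<lambda>n. ereal (N (path_prefix \<omega> n))) \<le> f (prepend s \<omega>)"
      by (auto simp: tail_submartingale_def)
    \<comment> \<open>Off the continuations of \<open>s\<close> the process is frozen at its value in \<open>s\<close>.\<close>
    define M where "M t = (if take (length s) t = s then N (drop (length s) t) else N [])" for t
    have M_append: "M (s @ u) = N u" for u by (simp add: M_def)
    have "submartingale Q M"
      unfolding submartingale_def
    proof
      fix t
      show "0 \<le> Q t (process_difference M t)"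
      proof (cases "take (length s) t = s")
        case True
        then obtain u where t: "t = s @ u" by (metis append_take_drop_id)
        show ?thesis
          using N(1)[of u] by (simp add: t process_difference_def[abs_def] M_append)
      next
        case False
        have "M (t @ [x]) = M t" for x
        proof (cases "take (length s) (t @ [x]) = s")
          case True
          with False have "length s = Suc (length t)"
            by (cases "length s \<le> length t") (auto simp: min_def dest: arg_cong[of _ _ length])
          then show ?thesis using True False by (simp add: M_def)
        qed (use False in \<open>simp add: M_def\<close>)
        then have "process_difference M t = (\<lambda>_. 0)"
          by (simp add: process_difference_def fun_eq_iff)
        then show ?thesis
          by (simp add: lower_expectation_zero[OF imprecise_markov_chain_lower_expectation[OF Q]])
      qed
    qed
    moreover have "bdd_above (range M)"
      by (rule bdd_above_mono[OF N(2)]) (auto simp: M_def)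
    moreover have "limsup (\<lambda>n. ereal (M (path_prefix \<omega> n))) \<le> f \<omega>" if "\<omega> \<in> cylinder s" for \<omega>
    proof -
      from that obtain \<omega>' where "\<omega> = prepend s \<omega>'" by (auto simp: cylinder_eq_range_prepend)
      then show ?thesis
        using N(3)[of \<omega>'] limsup_path_prefix_prepend[of "\<lambda>t. ereal (M t)" s \<omega>']
        by (simp add: M_append)
    qed
    moreover have "a = ereal (M s)" using M_append[of "[]"] a by simp
    ultimately show ?L by blast
  qed
  then show ?thesis by (simp only: global_lower_expectation_def)
qed

lemma tail_submartingale_le_global_lower_expectation:
  assumes "imprecise_markov_chain Q" "tail_submartingale Q s f N"
  shows "ereal (N []) \<le> global_lower_expectation Q f s"
  unfolding global_lower_expectation_eq_Sup_tail[OF assms(1)]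
  by (rule Sup_upper, rule CollectI, rule exI[of _ N]) (simp add: assms(2))

text \<open>The Markov property: the states \<open>s\<close> before a nonempty situation \<open>t\<close> have no influence on the
  local models, so they matter only through the variable itself.\<close>

lemma global_lower_expectation_Markov:
  assumes Q: "imprecise_markov_chain Q" and "t \<noteq> []"
    and f: "\<And>\<omega>. f (prepend (s @ t) \<omega>) = g (prepend t \<omega>)"
  shows "global_lower_expectation Q f (s @ t) = global_lower_expectation Q g t"
proof -
  have "tail_submartingale Q (s @ t) f N \<longleftrightarrow> tail_submartingale Q t g N" for N
    using \<open>t \<noteq> []\<close> by (simp add: tail_submartingale_def f imprecise_markov_chain_append[OF Q])
  then show ?thesis by (simp add: global_lower_expectation_eq_Sup_tail[OF Q])
qed

lemma global_lower_expectation_add_const: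
  assumes Q: "imprecise_markov_chain Q"
  shows "global_lower_expectation Q (\<lambda>\<omega>. ereal c + f \<omega>) s =
    ereal c + global_lower_expectation Q f s"
proof (rule antisym)
  have *: "global_lower_expectation Q f' s \<le>
      ereal (- b) + global_lower_expectation Q (\<lambda>\<omega>. ereal b + f' \<omega>) s" for f' b
    unfolding global_lower_expectation_eq_Sup_tail[OF Q, of f']
  proof (rule Sup_least, clarify)
    fix N assume N: "tail_submartingale Q s f' N"
    have "tail_submartingale Q s (\<lambda>\<omega>. ereal b + f' \<omega>) (\<lambda>u. b + N u)"
      unfolding tail_submartingale_def
    proof (intro conjI allI)
      show "0 \<le> Q (s @ u) (process_difference (\<lambda>u. b + N u) u)" for u
        using N by (simp add: tail_submartingale_def process_difference_def[abs_def])
      obtain B where "\<And>u. N u \<le> B"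
        using N by (auto simp: tail_submartingale_def bdd_above_def)
      then show "bdd_above (range (\<lambda>u. b + N u))"
        by (intro bdd_aboveI[of _ "b + B"]) auto
      fix \<omega>
      have "limsup (\<lambda>n. ereal (b + N (path_prefix \<omega> n)))
          = ereal b + limsup (\<lambda>n. ereal (N (path_prefix \<omega> n)))"
        by (subst Limsup_add_ereal_left[symmetric]) simp_all
      also have "\<dots> \<le> ereal b + f' (prepend s \<omega>)"
        using N by (intro add_left_mono) (simp add: tail_submartingale_def)
      finally show "limsup (\<lambda>n. ereal (b + N (path_prefix \<omega> n))) \<le> ereal b + f' (prepend s \<omega>)" .
    qed
    from tail_submartingale_le_global_lower_expectation[OF Q this]
    have "ereal b + ereal (N []) \<le> global_lower_expectation Q (\<lambda>\<omega>. ereal b + f' \<omega>) s" by simp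
    then show "ereal (N []) \<le> ereal (- b) + global_lower_expectation Q (\<lambda>\<omega>. ereal b + f' \<omega>) s"
      by (simp only: ereal_add_le_iff)
  qed
  show "global_lower_expectation Q (\<lambda>\<omega>. ereal c + f \<omega>) s \<le>
      ereal c + global_lower_expectation Q f s"
    using *[of "\<lambda>\<omega>. ereal c + f \<omega>" "-c"]
    by (simp add: add.assoc[symmetric] zero_ereal_def[symmetric])
  show "ereal c + global_lower_expectation Q f s \<le>
      global_lower_expectation Q (\<lambda>\<omega>. ereal c + f \<omega>) s"
    using *[of f c] by (simp only: ereal_add_le_iff)
qed

text \<open>A submartingale can always be continued without decrease, because a gamble with nonnegative
  lower expectation is nonnegative somewhere; along the path obtained this way the limit superior
  is at least the initial value.\<close>

lemma tail_submartingale_nondecreasing_path: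
  assumes Q: "imprecise_markov_chain Q" and N: "tail_submartingale Q s f N"
  obtains \<omega> where "\<And>n. N [] \<le> N (path_prefix \<omega> n)"
proof -
  have ex: "\<exists>z. N u \<le> N (u @ [z])" for u
    using lower_expectation_nonneg_witness[OF imprecise_markov_chain_lower_expectation[OF Q],
        of "s @ u" "process_difference N u"] N
    by (auto simp: tail_submartingale_def process_difference_def)
  \<comment> \<open>The path and its prefixes \<open>p n\<close> are built together by greedy choice of the next state.\<close>
  define nxt where "nxt u = (SOME z. N u \<le> N (u @ [z]))" for u
  have nxt: "N u \<le> N (u @ [nxt u])" for u
    unfolding nxt_def by (rule someI_ex[OF ex])
  define p where "p n = ((\<lambda>u. u @ [nxt u]) ^^ n) []" for n
  have p_simps: "p 0 = []" "p (Suc n) = p n @ [nxt (p n)]" for n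
    by (simp_all add: p_def)
  have prefix: "path_prefix (\<lambda>n. nxt (p n)) n = p n" for n
    by (induction n) (simp_all add: path_prefix_def p_simps)
  have "N [] \<le> N (p n)" for n
    by (induction n) (auto simp: p_simps intro: order_trans[OF _ nxt])
  then show thesis by (intro that[of "\<lambda>n. nxt (p n)"]) (simp add: prefix)
qed

lemma global_lower_expectation_const:
  assumes Q: "imprecise_markov_chain Q" and f: "\<And>\<omega>. f (prepend s \<omega>) = ereal c"
  shows "global_lower_expectation Q f s = ereal c"
proof (rule antisym)
  show "global_lower_expectation Q f s \<le> ereal c"
    unfolding global_lower_expectation_eq_Sup_tail[OF Q]
  proof (rule Sup_least, clarify)
    fix N assume N: "tail_submartingale Q s f N"
    obtain \<omega> where \<omega>: "\<And>n. N [] \<le> N (path_prefix \<omega> n)"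
      using tail_submartingale_nondecreasing_path[OF Q N] by blast
    have "ereal (N []) = limsup (\<lambda>n::nat. ereal (N []))"
      by (simp add: Limsup_const)
    also have "\<dots> \<le> limsup (\<lambda>n. ereal (N (path_prefix \<omega> n)))"
      using \<omega> by (intro Limsup_mono) simp
    also have "\<dots> \<le> ereal c"
      using N[unfolded tail_submartingale_def, THEN conjunct2, THEN conjunct2, THEN spec, of \<omega>]
      by (simp only: f)
    finally show "ereal (N []) \<le> ereal c" .
  qed
  have "tail_submartingale Q s f (\<lambda>_. c)"
    by (simp add: tail_submartingale_def process_difference_def[abs_def] f Limsup_const
        lower_expectation_zero[OF imprecise_markov_chain_lower_expectation[OF Q]])
  from tail_submartingale_le_global_lower_expectation[OF Q this]
  show "ereal c \<le> global_lower_expectation Q f s" .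
qed

section \<open>Iterated lower expectations\<close>

lemma path_prefix_Suc: "path_prefix \<omega> (Suc n) = \<omega> 0 # path_prefix (\<lambda>i. \<omega> (Suc i)) n"
  using path_prefix_prepend[of "[\<omega> 0]" "\<lambda>i. \<omega> (Suc i)" n] by (simp add: prepend_singleton_tail)

text \<open>The global lower expectation in a situation is obtained from those in its children by the
  local model. A submartingale restricts to the children; conversely, nearly optimal submartingales
  in the finitely many children are glued together, with the local lower expectation of their
  initial values put in the parent.\<close>

lemma global_lower_expectation_step:
  assumes Q: "imprecise_markov_chain Q"
  shows "global_lower_expectation Q f [x] =
    lower_transition Q (\<lambda>z. global_lower_expectation Q f [x, z]) x"
proof (rule antisym)
  show "global_lower_expectation Q f [x] \<le>
      lower_transition Q (\<lambda>z. global_lower_expectation Q f [x, z]) x"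
    unfolding global_lower_expectation_eq_Sup_tail[OF Q, of f "[x]"]
  proof (rule Sup_least, clarify)
    fix N assume N: "tail_submartingale Q [x] f N"
    have "0 \<le> Q [x] (\<lambda>z. N [z] + (- N []))"
      using N[unfolded tail_submartingale_def, THEN conjunct1, THEN spec, of "[]"]
      by (simp add: process_difference_def[abs_def])
    then have "N [] \<le> Q [x] (\<lambda>z. N [z])"
      by (simp only: lower_expectation_add_const[OF imprecise_markov_chain_lower_expectation[OF Q]])
    moreover have "ereal (N [z]) \<le> global_lower_expectation Q f [x, z]" for z
    proof -
      have "tail_submartingale Q [x, z] f (\<lambda>u. N (z # u))"
        unfolding tail_submartingale_def
      proof (intro conjI allI)
        show "0 \<le> Q ([x, z] @ u) (process_difference (\<lambda>u. N (z # u)) u)" for u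
          using N[unfolded tail_submartingale_def, THEN conjunct1, THEN spec, of "z # u"]
          by (simp add: process_difference_def[abs_def])
        show "bdd_above (range (\<lambda>u. N (z # u)))"
          by (rule bdd_above_mono[of "range N"]) (use N in \<open>auto simp: tail_submartingale_def\<close>)
        fix \<omega>
        have "limsup (\<lambda>n. ereal (N (path_prefix (prepend [z] \<omega>) n))) \<le> f (prepend [x] (prepend [z] \<omega>))"
          using N by (simp add: tail_submartingale_def)
        then show "limsup (\<lambda>n. ereal (N (z # path_prefix \<omega> n))) \<le> f (prepend [x, z] \<omega>)"
          using limsup_path_prefix_prepend[of "\<lambda>u. ereal (N u)" "[z]" \<omega>]
            prepend_append[of "[x]" "[z]" \<omega>] by simp
      qed
      from tail_submartingale_le_global_lower_expectation[OF Q this] show ?thesis .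
    qed
    ultimately show "ereal (N []) \<le>
        lower_transition Q (\<lambda>z. global_lower_expectation Q f [x, z]) x"
      unfolding lower_transition_def
      by (intro Sup_upper2[of "ereal (Q [x] (\<lambda>z. N [z]))"]) auto
  qed
  show "lower_transition Q (\<lambda>z. global_lower_expectation Q f [x, z]) x \<le>
      global_lower_expectation Q f [x]"
    unfolding lower_transition_def
  proof (rule Sup_least, clarify)
    fix h assume h: "\<forall>z. ereal (h z) \<le> global_lower_expectation Q f [x, z]"
    show "ereal (Q [x] h) \<le> global_lower_expectation Q f [x]"
    proof (rule ereal_le_epsilon2)
      fix e :: real assume "0 < e"
      have "\<exists>N. tail_submartingale Q [x, z] f N \<and> h z - e < N []" for z
      proof -
        have "ereal (h z - e) < ereal (h z)" using \<open>0 < e\<close> by simp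
        also have "\<dots> \<le> global_lower_expectation Q f [x, z]" using h by simp
        finally show ?thesis
          unfolding global_lower_expectation_eq_Sup_tail[OF Q] less_Sup_iff by auto
      qed
      then have "\<exists>N. \<forall>z. tail_submartingale Q [x, z] f (N z) \<and> h z - e < N z []"
        by (intro choice) blast
      then obtain N where N: "\<And>z. tail_submartingale Q [x, z] f (N z)" "\<And>z. h z - e < N z []"
        by blast
      \<comment> \<open>In \<open>[x]\<close> the initial values \<open>N z [] > h z - e\<close> are only worth \<open>Q [x] h - e\<close>.\<close>
      define M where "M u = (case u of [] \<Rightarrow> Q [x] h - e | z # u' \<Rightarrow> N z u')" for u
      have M_simps: "M [] = Q [x] h - e" "M (z # u) = N z u" for z u
        by (simp_all add: M_def)
      have "tail_submartingale Q [x] f M"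
        unfolding tail_submartingale_def
      proof (intro conjI allI)
        show "0 \<le> Q ([x] @ u) (process_difference M u)" for u
        proof (cases u)
          case Nil
          have "0 = Q [x] h + (- Q [x] h)" by simp
          also have "\<dots> = Q [x] (\<lambda>z. h z + (- Q [x] h))"
            by (rule lower_expectation_add_const[symmetric])
              (rule imprecise_markov_chain_lower_expectation[OF Q])
          also have "\<dots> \<le> Q [x] (process_difference M [])"
          proof (rule lower_expectation_mono[OF imprecise_markov_chain_lower_expectation[OF Q]])
            show "h z + (- Q [x] h) \<le> process_difference M [] z" for z
              using N(2)[of z] by (simp add: process_difference_def M_simps)
          qed
          finally show ?thesis by (simp add: Nil)
        next
          case (Cons z u')
          then show ?thesis
            using N(1)[of z, unfolded tail_submartingale_def, THEN conjunct1, THEN spec, of u']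
            by (simp add: process_difference_def[abs_def] M_simps)
        qed
        have "range M \<subseteq> insert (M []) (\<Union>z. range (N z))"
        proof clarify
          fix u assume "M u \<notin> (\<Union>z. range (N z))"
          then show "M u = M []" by (cases u) (auto simp: M_simps)
        qed
        moreover have "bdd_above (insert (M []) (\<Union>z. range (N z)))"
          using N(1) by (simp add: tail_submartingale_def)
        ultimately show "bdd_above (range M)" by (rule bdd_above_mono[rotated])
        fix \<omega> :: "nat \<Rightarrow> 'a"
        let ?\<omega> = "\<lambda>i. \<omega> (Suc i)"
        have "limsup (\<lambda>n. ereal (M (path_prefix \<omega> n)))
            = limsup (\<lambda>n. ereal (M (path_prefix \<omega> (Suc n))))"
          using limsup_shift[of "\<lambda>n. ereal (M (path_prefix \<omega> n))"] by simp
        also have "\<dots> = limsup (\<lambda>n. ereal (N (\<omega> 0) (path_prefix ?\<omega> n)))"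
          by (simp add: path_prefix_Suc M_simps)
        also have "\<dots> \<le> f (prepend [x, \<omega> 0] ?\<omega>)"
          using N(1) by (simp add: tail_submartingale_def)
        also have "prepend [x, \<omega> 0] ?\<omega> = prepend [x] \<omega>"
          using prepend_append[of "[x]" "[\<omega> 0]" ?\<omega>] by (simp add: prepend_singleton_tail)
        finally show "limsup (\<lambda>n. ereal (M (path_prefix \<omega> n))) \<le> f (prepend [x] \<omega>)" .
      qed
      from tail_submartingale_le_global_lower_expectation[OF Q this]
      have "ereal (Q [x] h - e) \<le> global_lower_expectation Q f [x]" by (simp add: M_simps)
      then show "ereal (Q [x] h) \<le> global_lower_expectation Q f [x] + ereal e"
        by (cases "global_lower_expectation Q f [x]") auto
    qed
  qed
qed

text \<open>First-step analysis: each \<open>f z\<close> is the constant \<open>c\<close> if the next state is \<open>y\<close>, and otherwise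
  \<open>c\<close> more than the variable of the next state on the rest of the path.\<close>

lemma global_lower_expectation_first_step:
  assumes Q: "imprecise_markov_chain Q"
    and hit: "\<And>x \<omega>. f x (prepend [x, y] \<omega>) = ereal c"
    and miss: "\<And>x z \<omega>. z \<noteq> y \<Longrightarrow> f x (prepend [x, z] \<omega>) = ereal c + f z (prepend [z] \<omega>)"
  shows "global_lower_expectation Q (f x) [x] = ereal c +
    lower_transition Q (\<lambda>z. if z = y then 0 else global_lower_expectation Q (f z) [z]) x"
proof -
  have "global_lower_expectation Q (f x) [x, z] =
      ereal c + (if z = y then 0 else global_lower_expectation Q (f z) [z])" for z
  proof (cases "z = y")
    case True
    then show ?thesis using global_lower_expectation_const[OF Q] hit by simp
  next
    case False
    have "global_lower_expectation Q (f x) ([x] @ [z]) =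
        global_lower_expectation Q (\<lambda>\<omega>. ereal c + f z \<omega>) [z]"
      by (rule global_lower_expectation_Markov[OF Q]) (simp_all add: miss[OF False])
    then show ?thesis
      using False by (simp add: global_lower_expectation_add_const[OF Q])
  qed
  then show ?thesis
    by (subst global_lower_expectation_step[OF Q]) (simp add: lower_transition_add_const[OF Q])
qed

section \<open>Transition times\<close>

lemma transition_time_hit: "transition_time x y (prepend [x, y] \<omega>) = 1"
proof -
  let ?\<omega> = "prepend [x, y] \<omega>"
  have "Inf {ereal (real m) | m. m \<ge> 1 \<and> ?\<omega> m = y} = 1"
  proof (rule antisym)
    show "Inf {ereal (real m) | m. m \<ge> 1 \<and> ?\<omega> m = y} \<le> 1"
    proof (rule Inf_lower, rule CollectI, intro exI conjI)
      show "1 = ereal (real 1)" by simp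
      show "?\<omega> 1 = y" by (simp add: prepend_def)
    qed simp
    show "1 \<le> Inf {ereal (real m) | m. m \<ge> 1 \<and> ?\<omega> m = y}"
    proof (rule Inf_greatest, clarify)
      fix m :: nat assume "m \<ge> 1"
      then have "ereal 1 \<le> ereal (real m)" by (simp del: ereal_eq_1)
      then show "1 \<le> ereal (real m)" by simp
    qed
  qed
  then show ?thesis by (simp add: transition_time_def)
qed

lemma transition_time_miss:
  assumes "z \<noteq> y"
  shows "transition_time x y (prepend [x, z] \<omega>) = 1 + transition_time z y (prepend [z] \<omega>)"
proof -
  let ?\<omega> = "prepend [z] \<omega>"
  let ?A = "{ereal (real m) | m. m \<ge> 1 \<and> ?\<omega> m = y}"
  have "{ereal (real m) | m. m \<ge> 1 \<and> prepend [x, z] \<omega> m = y} = (\<lambda>a. ereal 1 + a) ` ?A" (is "?B = _")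
  proof
    show "?B \<subseteq> (\<lambda>a. ereal 1 + a) ` ?A"
    proof clarify
      fix m :: nat assume m: "m \<ge> 1" "y = prepend [x, z] \<omega> m"
      then obtain k where k: "m = Suc k" by (cases m) auto
      with m have y: "prepend [z] \<omega> k = y" by simp
      with assms have "k \<noteq> 0" by (metis prepend_Cons_0)
      then have "ereal (real k) \<in> {ereal (real m) | m. m \<ge> 1 \<and> ?\<omega> m = y}" using y by auto
      then show "ereal (real m) \<in> (\<lambda>a. ereal 1 + a) ` {ereal (real n) | n. n \<ge> 1 \<and> ?\<omega> n = prepend [x, z] \<omega> m}"
        using m(2) k by (intro image_eqI[of _ _ "ereal (real k)"]) auto
    qed
    show "(\<lambda>a. ereal 1 + a) ` ?A \<subseteq> ?B"
    proof clarify
      fix m :: nat assume "m \<ge> 1" "y = prepend [z] \<omega> m"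
      then show "\<exists>n. ereal 1 + ereal (real m) = ereal (real n) \<and> n \<ge> 1 \<and>
          prepend [x, z] \<omega> n = prepend [z] \<omega> m"
        by (intro exI[of _ "Suc m"]) simp
    qed
  qed
  moreover have "Inf ((\<lambda>a. ereal 1 + a) ` ?A) = ereal 1 + Inf ?A"
  proof (rule antisym)
    have "ereal (-1) + Inf ((\<lambda>a. ereal 1 + a) ` ?A) \<le> Inf ?A"
    proof (rule Inf_greatest)
      fix a assume "a \<in> ?A"
      then have "Inf ((\<lambda>a. ereal 1 + a) ` ?A) \<le> ereal 1 + a" by (intro Inf_lower) auto
      then show "ereal (-1) + Inf ((\<lambda>a. ereal 1 + a) ` ?A) \<le> a"
        by (simp only: ereal_add_le_iff minus_minus)
    qed
    then show "Inf ((\<lambda>a. ereal 1 + a) ` ?A) \<le> ereal 1 + Inf ?A"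
      by (simp only: ereal_add_le_iff minus_minus)
    show "ereal 1 + Inf ?A \<le> Inf ((\<lambda>a. ereal 1 + a) ` ?A)"
      by (intro INF_greatest add_left_mono Inf_lower)
  qed
  ultimately show ?thesis by (simp add: transition_time_def one_ereal_def)
qed

lemma sum_indicator_mult_ereal:
  fixes g :: "'a::finite \<Rightarrow> ereal"
  shows "(\<Sum>z\<in>UNIV - {y}. indicator {z} w * g z) = (if w = y then 0 else g w)"
proof -
  have "(\<Sum>z\<in>UNIV - {y}. indicator {z} w * g z) = (\<Sum>z\<in>UNIV - {y}. if w = z then g z else 0)"
    by (intro sum.cong) (auto simp: indicator_def)
  then show ?thesis by simp
qed

theorem mainTheorem9:
  fixes Q :: "'a::finite list \<Rightarrow> ('a \<Rightarrow> real) \<Rightarrow> real"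
  assumes "imprecise_markov_chain Q"
  shows "(\<forall>x y. lower_transition_time Q x y =
            1 + lower_transition Q
                  (\<lambda>w. \<Sum>z\<in>UNIV - {y}. indicator {z} w * lower_transition_time Q z y) x) \<and>
         (\<forall>x y. upper_transition_time Q x y =
            1 + upper_transition Q
                  (\<lambda>w. \<Sum>z\<in>UNIV - {y}. indicator {z} w * upper_transition_time Q z y) x)"
proof (intro conjI allI)
  fix x y
  show "lower_transition_time Q x y = 1 + lower_transition Q
      (\<lambda>w. \<Sum>z\<in>UNIV - {y}. indicator {z} w * lower_transition_time Q z y) x"
    using global_lower_expectation_first_step[OF assms, of "\<lambda>x. transition_time x y" y 1 x]
    by (simp add: transition_time_hit transition_time_miss sum_indicator_mult_ereal
        lower_transition_time_def one_ereal_def)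
  let ?L = "lower_transition Q (\<lambda>z. if z = y then 0
    else global_lower_expectation Q (\<lambda>\<omega>. - transition_time z y \<omega>) [z]) x"
  have "global_lower_expectation Q (\<lambda>\<omega>. - transition_time x y \<omega>) [x] = ereal (-1) + ?L"
  proof (rule global_lower_expectation_first_step[OF assms])
    show "- transition_time x y (prepend [x, y] \<omega>) = ereal (-1)" for x \<omega>
      by (simp add: transition_time_hit one_ereal_def)
    show "- transition_time x y (prepend [x, z] \<omega>) =
        ereal (-1) + - transition_time z y (prepend [z] \<omega>)" if "z \<noteq> y" for x z \<omega>
      using that by (cases "transition_time z y (prepend [z] \<omega>)")
        (simp_all add: transition_time_miss one_ereal_def)
  qed
  moreover have "(\<lambda>w. - (\<Sum>z\<in>UNIV - {y}. indicator {z} w * upper_transition_time Q z y)) =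
      (\<lambda>z. if z = y then 0 else global_lower_expectation Q (\<lambda>\<omega>. - transition_time z y \<omega>) [z])"
    unfolding sum_indicator_mult_ereal
    by (auto simp: fun_eq_iff upper_transition_time_def global_upper_expectation_def)
  moreover have "- (ereal (-1) + ?L) = 1 + - ?L"
    by (cases ?L) (simp_all add: one_ereal_def)
  ultimately show "upper_transition_time Q x y = 1 + upper_transition Q
      (\<lambda>w. \<Sum>z\<in>UNIV - {y}. indicator {z} w * upper_transition_time Q z y) x"
    by (simp add: upper_transition_time_def[of Q x] global_upper_expectation_def upper_transition_def)
qed

end
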